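(* There exist infinitely many (pairwise non-isomorphic) $4$-connected $4$-regular graphs $G$ with $\chi_c'(G) = \frac{9}{2}$.
   Context: Graphs are finite and simple (no loops, no parallel edges). For a real number $r$, a circular $r$-edge-colouring of $G$ is a map $c$ assigning to each edge of $G$ a real number in $[0,r)$ such that any two distinct edges $e,f$ sharing an end-vertex satisfy $1\le |c(e)-c(f)|\le r-1$. The circular chromatic index $\chi_c'(G)$ is the infimum (attained for finite graphs) of all $r$ such that $G$ admits a circular $r$-edge-colouring. "$4$-connected" refers to vertex connectivity. *)

theory Defs
  imports Complex_Main
begin

record 'a ugraph =
  verts :: "'a set"
  edges :: "'a set set"

definition simple_graph :: "'a ugraph \<Rightarrow> bool" where
  "simple_graph G \<longleftrightarrow>
     finite (verts G) \<and> (\<forall>e\<in>edges G. e \<subseteq> verts G \<and> card e = 2)"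

definition degree :: "'a ugraph \<Rightarrow> 'a \<Rightarrow> nat" where
  "degree G v = card {e \<in> edges G. v \<in> e}"

definition regular :: "nat \<Rightarrow> 'a ugraph \<Rightarrow> bool" where
  "regular k G \<longleftrightarrow> (\<forall>v\<in>verts G. degree G v = k)"

definition adj_rel :: "'a ugraph \<Rightarrow> ('a \<times> 'a) set" where
  "adj_rel G = {(u, v). {u, v} \<in> edges G}"

definition connected_graph :: "'a ugraph \<Rightarrow> bool" where
  "connected_graph G \<longleftrightarrow>
     verts G \<noteq> {} \<and> (\<forall>u\<in>verts G. \<forall>v\<in>verts G. (u, v) \<in> (adj_rel G)\<^sup>*)"

definition delete_verts :: "'a ugraph \<Rightarrow> 'a set \<Rightarrow> 'a ugraph" where
  "delete_verts G X =
     \<lparr>verts = verts G - X, edges = {e \<in> edges G. e \<inter> X = {}}\<rparr>"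

definition vertex_connected :: "nat \<Rightarrow> 'a ugraph \<Rightarrow> bool" where
  "vertex_connected k G \<longleftrightarrow>
     card (verts G) > k \<and>
     (\<forall>X. X \<subseteq> verts G \<and> card X < k \<longrightarrow> connected_graph (delete_verts G X))"

definition circular_edge_colouring :: "'a ugraph \<Rightarrow> real \<Rightarrow> ('a set \<Rightarrow> real) \<Rightarrow> bool" where
  "circular_edge_colouring G r c \<longleftrightarrow>
     (\<forall>e\<in>edges G. 0 \<le> c e \<and> c e < r) \<and>
     (\<forall>e\<in>edges G. \<forall>f\<in>edges G. e \<noteq> f \<and> e \<inter> f \<noteq> {} \<longrightarrow>
        1 \<le> \<bar>c e - c f\<bar> \<and> \<bar>c e - c f\<bar> \<le> r - 1)"

text \<open>For a finite graph with at least one edge the set below is nonempty and bounded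
  below by 0. For an edgeless graph it is all of \<open>\<real>\<close>, so there the value is meaningless.\<close>

definition circular_chromatic_index :: "'a ugraph \<Rightarrow> real" where
  "circular_chromatic_index G = Inf {r. \<exists>c. circular_edge_colouring G r c}"

definition graph_iso :: "'a ugraph \<Rightarrow> 'b ugraph \<Rightarrow> bool" where
  "graph_iso G H \<longleftrightarrow>
     (\<exists>f. bij_betw f (verts G) (verts H) \<and>
          (\<forall>u\<in>verts G. \<forall>v\<in>verts G. {u, v} \<in> edges G \<longleftrightarrow> {f u, f v} \<in> edges H))"

end

theory Submission
  imports Defs
begin

text \<open>
  The graphs are the Cartesian products of a triangle with an odd cycle (West and Zhu, Circular
  chromatic indexes of Cartesian products of graphs). If \<open>r < 9/2\<close>, the four colours at a
  vertex have gaps in \<open>[1, 3/2)\<close> on the circle of length \<open>r\<close>, so within one copy of the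
  triangle and its six outgoing edges colours fall into four classes and form an ordinary
  4-edge-colouring, where two colours are in the same class iff they are less than \<open>1/2\<close> apart.
  At each vertex exactly one of the two outgoing edges has the class of the opposite triangle edge;
  the other one has the class missing on the triangle. Hence of the two bundles of three
  edges on either side of a triangle exactly one consists of three different classes.
  These bundles alternate along the cycle, which must therefore be even.
  For the upper bound, a colouring of the first five layers reverses the parity
  of the obvious 2-periodic colouring.
\<close>

section \<open>Separation and closeness on a circle of length \<open>r\<close>\<close>

definition sep :: "real \<Rightarrow> real \<Rightarrow> real \<Rightarrow> bool" where
  "sep r x y \<longleftrightarrow> 1 \<le> \<bar>x - y\<bar> \<and> \<bar>x - y\<bar> \<le> r - 1"

text \<open>Circular distance less than 1/2; the second disjunct is for pairs lying on the two sides
  of 0.\<close>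

definition close :: "real \<Rightarrow> real \<Rightarrow> real \<Rightarrow> bool" where
  "close r x y \<longleftrightarrow> \<bar>x - y\<bar> < 1 / 2 \<or> \<bar>x - y\<bar> > r - 1 / 2"

text \<open>The rotation taking \<open>s\<close> to 0, by which a chosen colour is normalised to
  0.\<close>

definition rot :: "real \<Rightarrow> real \<Rightarrow> real \<Rightarrow> real" where
  "rot r s x = (if s \<le> x then x - s else x - s + r)"

lemma rot_range: "x \<in> {0..<r} \<Longrightarrow> s \<in> {0..<r} \<Longrightarrow> rot r s x \<in> {0..<r}"
  by (auto simp: rot_def)

lemma rot_sep: "x \<in> {0..<r} \<Longrightarrow> y \<in> {0..<r} \<Longrightarrow> s \<in> {0..<r} \<Longrightarrow> sep r (rot r s x) (rot r s y) \<longleftrightarrow> sep r x y"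
  by (auto simp: rot_def sep_def abs_if)

lemma rot_close: "x \<in> {0..<r} \<Longrightarrow> y \<in> {0..<r} \<Longrightarrow> s \<in> {0..<r} \<Longrightarrow> close r (rot r s x) (rot r s y) \<longleftrightarrow> close r x y"
  by (auto simp: rot_def close_def abs_if)

lemma rot_sep_zero: "x \<in> {0..<r} \<Longrightarrow> s \<in> {0..<r} \<Longrightarrow> sep r 0 (rot r s x) \<longleftrightarrow> sep r s x"
  using rot_sep[of s r x s] by (simp add: rot_def)

lemma sep_cases:
  assumes "sep r x y"
  obtains "x + 1 \<le> y" "y \<le> x + (r - 1)" | "y + 1 \<le> x" "x \<le> y + (r - 1)"
  using assms by (fastforce simp: sep_def abs_if split: if_splits)

lemma sep_commute: "sep r x y \<longleftrightarrow> sep r y x"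
  by (simp add: sep_def abs_minus_commute)

text \<open>For \<open>r < 9/2\<close> this says that \<open>x\<close> lies in \<open>[k, k + (r - 4)]\<close> for some
  \<open>k \<in> {1, 2, 3}\<close>: the integer \<open>k\<close> is the class of \<open>x\<close> relative to an edge of colour \<open>0\<close>.\<close>

definition near_int :: "real \<Rightarrow> real \<Rightarrow> bool" where
  "near_int r x \<longleftrightarrow> \<lfloor>x\<rfloor> \<in> {1, 2, 3} \<and> frac x \<le> r - 4"

lemma near_intI:
  assumes "r < 9/2" "1 \<le> x \<and> x \<le> r - 3 \<or> 2 \<le> x \<and> x \<le> r - 2 \<or> 3 \<le> x \<and> x \<le> r - 1"
  shows "near_int r x"
  using assms(2)
proof (elim disjE)
  assume "1 \<le> x \<and> x \<le> r - 3"
  moreover from this have "\<lfloor>x\<rfloor> = 1" using assms(1) by (simp add: floor_eq_iff)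
  ultimately show ?thesis by (simp add: near_int_def frac_def)
next
  assume "2 \<le> x \<and> x \<le> r - 2"
  moreover from this have "\<lfloor>x\<rfloor> = 2" using assms(1) by (simp add: floor_eq_iff)
  ultimately show ?thesis by (simp add: near_int_def frac_def)
next
  assume "3 \<le> x \<and> x \<le> r - 1"
  moreover from this have "\<lfloor>x\<rfloor> = 3" using assms(1) by (simp add: floor_eq_iff)
  ultimately show ?thesis by (simp add: near_int_def frac_def)
qed

text \<open>Four points on the circle with gaps at least 1: the \<open>k\<close>-th one after 0 is
  at least \<open>k\<close> and at most \<open>r - (4 - k)\<close>. The order of \<open>x\<close>,
  \<open>y\<close>, \<open>z\<close> decides \<open>k\<close>.\<close>

lemma near_int_if_sep:
  assumes "r < 9/2" "0 \<le> x" "0 \<le> y" "0 \<le> z"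
    and "sep r 0 x" "sep r 0 y" "sep r 0 z" "sep r x y" "sep r x z" "sep r y z"
  shows "near_int r x"
proof (rule near_intI)
  have *: "1 \<le> x" "x \<le> r - 1" "1 \<le> y" "y \<le> r - 1" "1 \<le> z" "z \<le> r - 1"
    using assms by (auto simp: sep_def)
  show "1 \<le> x \<and> x \<le> r - 3 \<or> 2 \<le> x \<and> x \<le> r - 2 \<or> 3 \<le> x \<and> x \<le> r - 1"
    by (rule sep_cases[OF assms(8)]; rule sep_cases[OF assms(9)]; rule sep_cases[OF assms(10)]; use * in linarith)
qed (fact assms)

text \<open>Values of one class differ by at most \<open>r - 4 < 1/2\<close>. For different classes
  the difference is at least \<open>5 - r > 1/2\<close> and at most \<open>r - 2\<close>, so the
  values are far apart in both directions.\<close>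

lemma near_int_close:
  assumes "r < 9/2" "near_int r x" "near_int r y"
  shows "close r x y \<longleftrightarrow> \<lfloor>x\<rfloor> = \<lfloor>y\<rfloor>"
proof -
  obtain k d l e where x: "x = of_int k + d" "k = \<lfloor>x\<rfloor>" "k \<in> {1,2,3}" "0 \<le> d" "d \<le> r - 4"
    and y: "y = of_int l + e" "l = \<lfloor>y\<rfloor>" "l \<in> {1,2,3}" "0 \<le> e" "e \<le> r - 4"
    using assms(2,3) unfolding near_int_def
    by (metis floor_correct frac_def frac_ge_0 add.commute diff_add_cancel)
  show ?thesis
  proof (cases "k = l")
    case True
    then have "\<bar>x - y\<bar> < 1/2" using x(1,4,5) y(1,4,5) assms(1) by linarith
    then show ?thesis using True x(2) y(2) by (simp add: close_def)
  next
    case False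
    then have "1 \<le> \<bar>k - l\<bar>" "\<bar>k - l\<bar> \<le> 2" using x(3) y(3) by auto
    then have "1 \<le> \<bar>of_int k - of_int l :: real\<bar>" "\<bar>of_int k - of_int l :: real\<bar> \<le> 2" by linarith+
    then have "1/2 \<le> \<bar>x - y\<bar>" "\<bar>x - y\<bar> \<le> r - 1/2" using x(1,4,5) y(1,4,5) assms(1) by linarith+
    then show ?thesis using False x(2) y(2) by (auto simp: close_def)
  qed
qed

lemma sep_not_close: "sep r x y \<Longrightarrow> \<not> close r x y"
  by (auto simp: close_def sep_def)

lemma near_int_sep:
  "r < 9/2 \<Longrightarrow> near_int r x \<Longrightarrow> near_int r y \<Longrightarrow> sep r x y \<Longrightarrow> \<lfloor>x\<rfloor> \<noteq> \<lfloor>y\<rfloor>"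
  using near_int_close sep_not_close by blast

section \<open>Classes of colours around a triangle\<close>

text \<open>The triangle is coloured 0, \<open>t\<close>, \<open>u\<close>; the other colours at the
  ends of the edge coloured 0 are \<open>u\<close>, \<open>a\<close>, \<open>b\<close> and
  \<open>t\<close>, \<open>a'\<close>, \<open>b'\<close>. Only classes 1, 2, 3 remain:
  \<open>a\<close> and \<open>b\<close> take that of \<open>t\<close> and the third one,
  \<open>a'\<close> has that of \<open>u\<close> or the third, so \<open>a\<close> and
  \<open>a'\<close> can only meet in the third.\<close>

lemma layer_close_zero:
  assumes "r < 9/2" "t \<in> {0..<r}" "u \<in> {0..<r}" "a \<in> {0..<r}" "b \<in> {0..<r}" "a' \<in> {0..<r}" "b' \<in> {0..<r}"
   "sep r 0 u" "sep r 0 t" "sep r u t"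
   "sep r 0 a" "sep r 0 b" "sep r u a" "sep r u b" "sep r a b"
   "sep r 0 a'" "sep r 0 b'" "sep r t a'" "sep r t b'" "sep r a' b'"
 shows "close r a t \<longleftrightarrow> \<not> close r b t"
   "close r a a' \<longleftrightarrow> \<not> close r a t \<and> \<not> close r a' u"
proof -
  have n: "near_int r t" "near_int r u" "near_int r a" "near_int r b" "near_int r a'" "near_int r b'"
    by (rule near_int_if_sep[of r t a' b'] near_int_if_sep[of r u a b] near_int_if_sep[of r a b u] near_int_if_sep[of r b a u]
      near_int_if_sep[of r a' b' t] near_int_if_sep[of r b' a' t]; insert assms; simp add: sep_commute)+
  note fl = near_int_sep[OF assms(1)]
  have tu: "\<lfloor>u\<rfloor> \<noteq> \<lfloor>t\<rfloor>" "\<lfloor>u\<rfloor> \<in> {1, 2, 3}" "\<lfloor>t\<rfloor> \<in> {1, 2, 3}"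
    and a: "\<lfloor>u\<rfloor> \<noteq> \<lfloor>a\<rfloor>" "\<lfloor>a\<rfloor> \<in> {1, 2, 3}"
    and b: "\<lfloor>u\<rfloor> \<noteq> \<lfloor>b\<rfloor>" "\<lfloor>a\<rfloor> \<noteq> \<lfloor>b\<rfloor>" "\<lfloor>b\<rfloor> \<in> {1, 2, 3}"
    and a': "\<lfloor>t\<rfloor> \<noteq> \<lfloor>a'\<rfloor>" "\<lfloor>a'\<rfloor> \<in> {1, 2, 3}"
    using fl[OF n(2,1) assms(10)] fl[OF n(2,3) assms(13)] fl[OF n(2,4) assms(14)] fl[OF n(3,4) assms(15)]
      fl[OF n(1,5) assms(18)] n by (simp_all add: near_int_def)
  show  "close r a t \<longleftrightarrow> \<not> close r b t"
    unfolding near_int_close[OF assms(1) n(3,1)] near_int_close[OF assms(1) n(4,1)]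
    using tu a b by (smt (verit) insert_iff empty_iff)
  show "close r a a' \<longleftrightarrow> \<not> close r a t \<and> \<not> close r a' u"
    unfolding near_int_close[OF assms(1) n(3,1)] near_int_close[OF assms(1) n(3,5)] near_int_close[OF assms(1) n(5,2)]
    using tu a a' by (smt (verit) insert_iff empty_iff)
qed

text \<open>Rotating by \<open>s\<close> reduces this to a base edge coloured 0.\<close>

lemma layer_close_base:
  assumes "r < 9/2" "s \<in> {0..<r}" "t \<in> {0..<r}" "u \<in> {0..<r}" "a \<in> {0..<r}" "b \<in> {0..<r}" "a' \<in> {0..<r}" "b' \<in> {0..<r}"
   "sep r s u" "sep r s t" "sep r u t"
   "sep r s a" "sep r s b" "sep r u a" "sep r u b" "sep r a b"
   "sep r s a'" "sep r s b'" "sep r t a'" "sep r t b'" "sep r a' b'"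
 shows "close r a t \<longleftrightarrow> \<not> close r b t"
   "close r a a' \<longleftrightarrow> \<not> close r a t \<and> \<not> close r a' u"
proof -
  note simps = assms rot_range rot_sep rot_sep_zero
  have "close r (rot r s a) (rot r s t) \<longleftrightarrow> \<not> close r (rot r s b) (rot r s t)"
    by (rule layer_close_zero(1)[of r "rot r s t" "rot r s u" "rot r s a" "rot r s b" "rot r s a'" "rot r s b'"]; simp only: simps)
  then show "close r a t \<longleftrightarrow> \<not> close r b t"
    by (simp only: assms rot_close)
  have "close r (rot r s a) (rot r s a') \<longleftrightarrow> \<not> close r (rot r s a) (rot r s t) \<and> \<not> close r (rot r s a') (rot r s u)"
    by (rule layer_close_zero(2)[of r "rot r s t" "rot r s u" "rot r s a" "rot r s b" "rot r s a'" "rot r s b'"]; simp only: simps)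
  then show "close r a a' \<longleftrightarrow> \<not> close r a t \<and> \<not> close r a' u"
    by (simp only: assms rot_close)
qed

text \<open>\<open>t j\<close> is the colour of the triangle edge opposite to vertex \<open>j\<close>; \<open>a j\<close> and \<open>b j\<close> are the
  colours of the two edges that leave the triangle at \<open>j\<close>.\<close>

definition layer :: "real \<Rightarrow> (nat \<Rightarrow> real) \<Rightarrow> (nat \<Rightarrow> real) \<Rightarrow> (nat \<Rightarrow> real) \<Rightarrow> bool" where
  "layer r t a b \<longleftrightarrow> (\<forall>j<3. {t j, a j, b j} \<subseteq> {0..<r} \<and>
     sep r (t ((j + 1) mod 3)) (t ((j + 2) mod 3)) \<and> sep r (a j) (b j) \<and>
     (\<forall>k<3. k \<noteq> j \<longrightarrow> sep r (t k) (a j) \<and> sep r (t k) (b j)))"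

lemma layer_swap: "layer r t a b \<Longrightarrow> layer r t b a"
  by (auto simp: layer_def sep_commute)

definition rainbow :: "real \<Rightarrow> (nat \<Rightarrow> real) \<Rightarrow> bool" where
  "rainbow r a \<longleftrightarrow> \<not> close r (a 0) (a 1) \<and> \<not> close r (a 0) (a 2) \<and> \<not> close r (a 1) (a 2)"

lemma less_3_cases: "j < 3 \<longleftrightarrow> j = 0 \<or> j = 1 \<or> j = (2::nat)"
  by auto

lemma layer_close:
  assumes "r < 9/2" "layer r t a b" "i < 3" "j < 3" "i \<noteq> j"
  shows "close r (a i) (t i) \<longleftrightarrow> \<not> close r (b i) (t i)"
    "close r (a i) (a j) \<longleftrightarrow> \<not> close r (a i) (t i) \<and> \<not> close r (a j) (t j)"
proof -
  \<comment> \<open>The third index: \<open>t k\<close> colours the triangle edge joining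
    \<open>i\<close> and \<open>j\<close>, which becomes the base edge.\<close>
  define k where "k = 3 - i - j"
  have k: "k < 3" "k \<noteq> i" "k \<noteq> j"
    using assms(3-5) unfolding k_def less_3_cases by (elim disjE; simp)+
  have rng: "t l \<in> {0..<r} \<and> a l \<in> {0..<r} \<and> b l \<in> {0..<r} \<and> sep r (a l) (b l)" if "l < 3" for l
    using assms(2) that unfolding layer_def by simp
  have tab: "sep r (t l) (a m) \<and> sep r (t l) (b m)" if "l < 3" "m < 3" "l \<noteq> m" for l m
    using assms(2) that unfolding layer_def by simp
  have cyc: "sep r (t ((l + 1) mod 3)) (t ((l + 2) mod 3))" if "l < 3" for l
    using assms(2) that unfolding layer_def by simp
  have "sep r (t 1) (t 2)" "sep r (t 2) (t 0)" "sep r (t 0) (t 1)"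
    using cyc[of 0] cyc[of 1] cyc[of 2] by (simp_all add: numeral_2_eq_2)
  then have tt: "\<And>l m. l < 3 \<Longrightarrow> m < 3 \<Longrightarrow> l \<noteq> m \<Longrightarrow> sep r (t l) (t m)"
    unfolding less_3_cases by (elim disjE; simp add: sep_commute)
  show "close r (a i) (t i) \<longleftrightarrow> \<not> close r (b i) (t i)"
    "close r (a i) (a j) \<longleftrightarrow> \<not> close r (a i) (t i) \<and> \<not> close r (a j) (t j)"
    by (rule layer_close_base[of r "t k" "t i" "t j" "a i" "b i" "a j" "b j"]; simp only: rng tt tab k assms(1,3-5) simp_thms not_sym)+
qed

text \<open>A bundle is rainbow iff at most one of its edges fails to be close to the opposite
  triangle edge. At each vertex exactly one of \<open>a\<close>, \<open>b\<close> fails, so the two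
  counts sum to 3 and exactly one of them is at most 1.\<close>

lemma layer_rainbow:
  assumes "r < 9/2" "layer r t a b"
  shows "rainbow r a \<longleftrightarrow> \<not> rainbow r b"
proof -
  note a = layer_close[OF assms] and b = layer_close(2)[OF assms(1) layer_swap[OF assms(2)]]
  have "close r (a j) (t j) \<longleftrightarrow> \<not> close r (b j) (t j)" if "j < 3" for j
    using a(1)[OF that, of "(j + 1) mod 3"] that by (auto simp: less_3_cases)
  from this[of 0] this[of 1] this[of 2] show ?thesis
    using a(2)[of 0 1] a(2)[of 0 2] a(2)[of 1 2] b[of 0 1] b[of 0 2] b[of 1 2]
    unfolding rainbow_def by simp blast
qed

section \<open>The product of a triangle and an \<open>n\<close>-cycle\<close>

definition pt :: "nat \<Rightarrow> nat \<Rightarrow> nat" where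
  "pt i j = 3 * i + j"

lemma pt_eq_iff: "j < 3 \<Longrightarrow> j' < 3 \<Longrightarrow> pt i j = pt i' j' \<longleftrightarrow> i = i' \<and> j = j'"
  unfolding pt_def by presburger

lemma pt_cases: obtains i j where "v = pt i j" "j < 3"
  by (metis pt_def mult_div_mod_eq mod_less_divisor zero_less_numeral)

lemma pt_less_iff: "j < 3 \<Longrightarrow> pt i j < 3 * n \<longleftrightarrow> i < n"
  unfolding pt_def by linarith

text \<open>Indexed by the opposite vertex \<open>j\<close>, to match \<open>t j\<close> in
  \<open>layer\<close>.\<close>

definition hedge :: "nat \<times> nat \<Rightarrow> nat set" where
  "hedge = (\<lambda>(i, j). {pt i ((j + 1) mod 3), pt i ((j + 2) mod 3)})"

definition vedge :: "nat \<Rightarrow> nat \<times> nat \<Rightarrow> nat set" where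
  "vedge n = (\<lambda>(i, j). {pt i j, pt (Suc i mod n) j})"

definition C3_prod_C :: "nat \<Rightarrow> nat ugraph" where
  "C3_prod_C n = \<lparr>verts = {..<3 * n}, edges = hedge ` ({..<n} \<times> {..<3}) \<union> vedge n ` ({..<n} \<times> {..<3})\<rparr>"

lemma verts_C3_prod_C_cases:
  assumes "v \<in> verts (C3_prod_C n)"
  obtains i j where "v = pt i j" "j < 3" "i < n"
  using assms by (metis C3_prod_C_def lessThan_iff pt_cases pt_less_iff ugraph.select_convs(1))

text \<open>Cyclic predecessor: the cycle edges entering layer \<open>i\<close> are
  \<open>vedge n (pre n i, j)\<close>.\<close>

definition pre :: "nat \<Rightarrow> nat \<Rightarrow> nat" where
  "pre n i = (if i = 0 then n - 1 else i - 1)"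

lemma pre_less: "i < n \<Longrightarrow> pre n i < n"
  by (auto simp: pre_def)

lemma Suc_mod_eq_iff: "i < n \<Longrightarrow> k < n \<Longrightarrow> Suc k mod n = i \<longleftrightarrow> k = pre n i"
  by (auto simp: pre_def mod_Suc)

lemma mem_hedge: "v < 3 \<Longrightarrow> j < 3 \<Longrightarrow> pt i v \<in> hedge (k, j) \<longleftrightarrow> i = k \<and> v \<noteq> j"
  by (auto simp: hedge_def pt_eq_iff less_3_cases)

lemma mem_vedge: "v < 3 \<Longrightarrow> j < 3 \<Longrightarrow> i < n \<Longrightarrow> k < n \<Longrightarrow> pt i v \<in> vedge n (k, j) \<longleftrightarrow> v = j \<and> (k = i \<or> k = pre n i)"
  using Suc_mod_eq_iff[of i n k] by (auto simp: vedge_def pt_eq_iff)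

lemma hedge_inj: "inj_on hedge ({..<n} \<times> {..<3})"
proof (rule inj_onI, clarsimp)
  fix i j i' j' assume j: "j < 3" "j' < (3::nat)" and eq: "hedge (i, j) = hedge (i', j')"
  have "v \<noteq> j \<longleftrightarrow> i = i' \<and> v \<noteq> j'" if "v < 3" for v
    using mem_hedge[OF that] eq j by metis
  from this[of 0] this[of 1] this[of 2] j(2) show "i = i' \<and> j = j'"
    using j(1) unfolding less_3_cases by (elim disjE; simp)
qed

text \<open>Matching the ends crosswise would force \<open>i' = i + 1\<close> and
  \<open>i = i' + 1\<close> modulo \<open>n\<close>, impossible for
  \<open>n \<ge> 3\<close>.\<close>

lemma vedge_inj:
  assumes n: "n \<ge> 3" shows "inj_on (vedge n) ({..<n} \<times> {..<3})"
proof (rule inj_onI, clarsimp)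
  fix i j i' j' assume j: "j < 3" "j' < (3::nat)" "i < n" "i' < n" and eq: "vedge n (i, j) = vedge n (i', j')"
  have *: "pt i j = pt i' j' \<and> pt (Suc i mod n) j = pt (Suc i' mod n) j' \<or>
     pt i j = pt (Suc i' mod n) j' \<and> pt (Suc i mod n) j = pt i' j'"
    using eq by (auto simp: vedge_def doubleton_eq_iff)
  then show "i = i' \<and> j = j'"
    using n j by (auto simp: pt_eq_iff mod_Suc split: if_splits)
qed

lemma hedge_neq_vedge: "j < 3 \<Longrightarrow> j' < 3 \<Longrightarrow> hedge (i, j) \<noteq> vedge n (i', j')"
  by (auto simp: hedge_def vedge_def doubleton_eq_iff pt_eq_iff less_3_cases)

definition star :: "nat \<Rightarrow> nat \<Rightarrow> nat \<Rightarrow> nat set set" where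
  "star n i j = {hedge (i, (j + 1) mod 3), hedge (i, (j + 2) mod 3), vedge n (i, j), vedge n (pre n i, j)}"

lemma star_eq:
  assumes "i < n" "j < 3"
  shows "{e \<in> edges (C3_prod_C n). pt i j \<in> e} = star n i j"
proof -
  have "{e \<in> hedge ` ({..<n} \<times> {..<3}). pt i j \<in> e} = {hedge (i, (j + 1) mod 3), hedge (i, (j + 2) mod 3)}"
  proof -
    have "{e \<in> hedge ` ({..<n} \<times> {..<3}). pt i j \<in> e} = hedge ` {(k, l). k = i \<and> l < 3 \<and> l \<noteq> j}"
      using assms by (auto simp: mem_hedge)
    also have "{(k, l). k = i \<and> l < 3 \<and> l \<noteq> j} = {(i, (j + 1) mod 3), (i, (j + 2) mod 3)}"
      using assms(2) by (auto simp: less_3_cases)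
    finally show ?thesis by simp
  qed
  moreover have "{e \<in> vedge n ` ({..<n} \<times> {..<3}). pt i j \<in> e} = {vedge n (i, j), vedge n (pre n i, j)}"
    using assms pre_less[OF assms(1)] by (auto simp: mem_vedge)
  moreover have "{e \<in> edges (C3_prod_C n). pt i j \<in> e} =
      {e \<in> hedge ` ({..<n} \<times> {..<3}). pt i j \<in> e} \<union> {e \<in> vedge n ` ({..<n} \<times> {..<3}). pt i j \<in> e}"
    unfolding C3_prod_C_def by auto
  ultimately show ?thesis
    unfolding star_def by (simp add: insert_commute)
qed

lemma pre_neq: "n \<ge> 3 \<Longrightarrow> i < n \<Longrightarrow> pre n i \<noteq> i"
  by (auto simp: pre_def)

lemma star_distinct:
  assumes "n \<ge> 3" "i < n" "j < 3"
  shows "distinct [hedge (i, (j + 1) mod 3), hedge (i, (j + 2) mod 3), vedge n (i, j), vedge n (pre n i, j)]"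
proof -
  have "hedge (i, (j + 1) mod 3) \<noteq> hedge (i, (j + 2) mod 3)"
    using inj_onD[OF hedge_inj[of n], of "(i, (j + 1) mod 3)" "(i, (j + 2) mod 3)"] assms
    by (auto simp: less_3_cases)
  moreover have "vedge n (i, j) \<noteq> vedge n (pre n i, j)"
    using inj_onD[OF vedge_inj[of n], of "(i, j)" "(pre n i, j)"] assms pre_neq[of n i] pre_less[of i n] by auto
  ultimately show ?thesis
    using assms by (simp add: hedge_neq_vedge)
qed

lemma simple_C3_prod_C:
  assumes "n \<ge> 3"
  shows "simple_graph (C3_prod_C n)"
proof -
  have "hedge (i, j) \<subseteq> {..<3 * n} \<and> card (hedge (i, j)) = 2" if "i < n" "j < 3" for i j
    using that by (auto simp: hedge_def pt_less_iff pt_eq_iff card_2_iff' less_3_cases)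
  moreover have "vedge n (i, j) \<subseteq> {..<3 * n} \<and> card (vedge n (i, j)) = 2" if "i < n" "j < 3" for i j
  proof -
    have "Suc i mod n \<noteq> i" "Suc i mod n < n" using that assms by (auto simp: mod_Suc)
    then show ?thesis using that by (auto simp: vedge_def pt_less_iff pt_eq_iff)
  qed
  ultimately show ?thesis
    unfolding simple_graph_def C3_prod_C_def
    by (simp only: ugraph.simps ball_Un ball_simps mem_Sigma_iff lessThan_iff split_paired_Ball_Sigma) blast
qed

lemma regular_C3_prod_C:
  assumes "n \<ge> 3"
  shows "regular 4 (C3_prod_C n)"
  unfolding regular_def
proof
  fix v assume "v \<in> verts (C3_prod_C n)"
  then obtain i j where v: "v = pt i j" "j < 3" "i < n"
    by (rule verts_C3_prod_C_cases)
  then show "degree (C3_prod_C n) v = 4"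
    using distinct_card[OF star_distinct[OF assms v(3,2)]] star_eq[OF v(3,2)]
    by (simp add: degree_def star_def)
qed

section \<open>Lower bound for odd \<open>n\<close>\<close>

lemma colouring_layer:
  assumes "n \<ge> 3" "circular_edge_colouring (C3_prod_C n) r c" "i < n"
  shows "layer r (\<lambda>j. c (hedge (i, j))) (\<lambda>j. c (vedge n (i, j))) (\<lambda>j. c (vedge n (pre n i, j)))"
proof -
  let ?E = "edges (C3_prod_C n)"
  have E: "hedge (i, j) \<in> ?E" "vedge n (i, j) \<in> ?E" "vedge n (pre n i, j) \<in> ?E" if "j < 3" for j
    using that assms(3) pre_less[OF assms(3)] by (auto simp: C3_prod_C_def)
  then have rng: "{c (hedge (i, j)), c (vedge n (i, j)), c (vedge n (pre n i, j))} \<subseteq> {0..<r}" if "j < 3" for j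
    using that assms(2) unfolding circular_edge_colouring_def by simp
  have S: "sep r (c e) (c f)" if "e \<in> star n i j" "f \<in> star n i j" "e \<noteq> f" "j < 3" for e f j
    using that assms(2) star_eq[OF assms(3) that(4)] unfolding circular_edge_colouring_def sep_def by blast
  have d: "hedge (i, (j + 1) mod 3) \<noteq> hedge (i, (j + 2) mod 3)" "vedge n (i, j) \<noteq> vedge n (pre n i, j)"
    if "j < 3" for j
    using star_distinct[OF assms(1,3) that] by auto
  have in_star: "hedge (i, k) \<in> star n i j" if "j < 3" "k < 3" "k \<noteq> j" for j k
  proof -
    have "k = (j + 1) mod 3 \<or> k = (j + 2) mod 3" using that unfolding less_3_cases by (elim disjE; simp)
    then show ?thesis by (auto simp: star_def)
  qed
  show ?thesis
    unfolding layer_def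
  proof (intro allI impI conjI)
    fix j :: nat assume j: "j < 3"
    show "sep r (c (hedge (i, (j + 1) mod 3))) (c (hedge (i, (j + 2) mod 3)))"
      by (rule S[OF _ _ d(1)[OF j] j]) (simp_all add: star_def)
    show "sep r (c (vedge n (i, j))) (c (vedge n (pre n i, j)))"
      by (rule S[OF _ _ d(2)[OF j] j]) (simp_all add: star_def)
    fix k :: nat assume k: "k < 3" "k \<noteq> j"
    show "sep r (c (hedge (i, k))) (c (vedge n (i, j)))" "sep r (c (hedge (i, k))) (c (vedge n (pre n i, j)))"
      by (rule S[OF in_star[OF j k] _ hedge_neq_vedge[OF k(1) j] j]; simp add: star_def)+
  qed (use rng in blast)
qed

lemma circular_edge_colouring_C3_prod_C_ge:
  assumes "n \<ge> 3" "odd n" "circular_edge_colouring (C3_prod_C n) r c"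
  shows "9 / 2 \<le> r"
proof (rule ccontr)
  assume "\<not> 9 / 2 \<le> r"
  define R where "R i = rainbow r (\<lambda>j. c (vedge n (i, j)))" for i
  have step: "R i \<longleftrightarrow> \<not> R (pre n i)" if "i < n" for i
    unfolding R_def using layer_rainbow[OF _ colouring_layer[OF assms(1,3) that]] \<open>\<not> 9 / 2 \<le> r\<close> by simp
  have "i < n \<Longrightarrow> R i \<longleftrightarrow> (R 0 \<longleftrightarrow> even i)" for i
  proof (induction i)
    case (Suc i)
    then show ?case using step[of "Suc i"] by (auto simp: pre_def)
  qed simp
  \<comment> \<open>As \<open>n - 1\<close> is even, \<open>R (n - 1)\<close> agrees with
    \<open>R 0\<close>, while the step across layer 0 says the opposite.\<close>
  from this[of "n - 1"] step[of 0] show False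
    using assms(1,2) by (auto simp: pre_def)
qed

section \<open>Upper bound: a circular edge-colouring with \<open>r = 9/2\<close>\<close>

text \<open>Converse of \<open>colouring_layer\<close>: two edges with a common vertex lie in the
  \<open>star\<close> of that vertex, so conditions on single layers suffice.\<close>

lemma layer_colouring:
  assumes "n \<ge> 3" and L: "\<And>i. i < n \<Longrightarrow> layer r (T i) (A i) (A (pre n i))"
  shows "\<exists>c. circular_edge_colouring (C3_prod_C n) r c"
proof -
  define I where "I = {..<n} \<times> {..<3::nat}"
  \<comment> \<open>Edges are decoded by inverting \<open>hedge\<close> and \<open>vedge n\<close>,
    whose images are disjoint; values off the graph are arbitrary.\<close>
  define c where "c e = (if e \<in> hedge ` I then case_prod T (inv_into I hedge e)
    else case_prod A (inv_into I (vedge n) e))" for e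
  have ch: "c (hedge (i, j)) = T i j" if "i < n" "j < 3" for i j
    using that inv_into_f_f[OF hedge_inj, of "(i, j)" n] by (auto simp: c_def I_def)
  have cv: "c (vedge n (i, j)) = A i j" if "i < n" "j < 3" for i j
  proof -
    have "vedge n (i, j) \<notin> hedge ` I"
      using hedge_neq_vedge that by (force simp: I_def)
    then show ?thesis
      using that inv_into_f_f[OF vedge_inj[OF assms(1)], of "(i, j)"] by (auto simp: c_def I_def)
  qed
  have lay: "{T i j, A i j, A (pre n i) j} \<subseteq> {0..<r}" "sep r (T i ((j + 1) mod 3)) (T i ((j + 2) mod 3))"
    "sep r (A i j) (A (pre n i) j)" if "i < n" "j < 3" for i j
    using L[OF that(1)] that(2) unfolding layer_def by simp_all
  have lay': "sep r (T i k) (A i j)" "sep r (T i k) (A (pre n i) j)" if "i < n" "j < 3" "k < 3" "k \<noteq> j" for i j k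
    using L[OF that(1)] that(2-) unfolding layer_def by simp_all
  have S: "sep r (c e) (c f)" if "e \<in> star n i j" "f \<in> star n i j" "e \<noteq> f" "i < n" "j < 3" for e f i j
  proof -
    have m: "(j + 1) mod 3 < 3" "(j + 2) mod 3 < 3" "(j + 1) mod 3 \<noteq> j" "(j + 2) mod 3 \<noteq> j"
      using that(5) unfolding less_3_cases by (elim disjE; simp)+
    note * = lay[OF that(4,5)] lay'[OF that(4,5) m(1,3)] lay'[OF that(4,5) m(2,4)]
    note ** = ch[OF that(4) m(1)] ch[OF that(4) m(2)] cv[OF that(4,5)] cv[OF pre_less[OF that(4)] that(5)]
    show ?thesis
      using that(1-3) unfolding star_def
      \<comment> \<open>The instances of symmetry bring each pair into the order used in
        \<open>lay\<close> and \<open>lay'\<close>.\<close>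
      by (elim insertE emptyE) (simp_all only: ** * sep_commute[of r "A _ _" "T _ _"] sep_commute[of r "A (pre n i) j" "A i j"]
        sep_commute[of r "T i ((j + 2) mod 3)" "T i ((j + 1) mod 3)"] simp_thms)
  qed
  show ?thesis
  proof (intro exI[of _ c], unfold circular_edge_colouring_def, intro conjI ballI impI)
    fix e assume "e \<in> edges (C3_prod_C n)"
    then have "c e \<in> {0..<r}"
      unfolding C3_prod_C_def using lay(1) by (auto simp: ch cv)
    then show "0 \<le> c e" "c e < r" by auto
  next
    fix e f assume ef: "e \<in> edges (C3_prod_C n)" "f \<in> edges (C3_prod_C n)" "e \<noteq> f \<and> e \<inter> f \<noteq> {}"
    then obtain v where v: "v \<in> e" "v \<in> f" by blast
    then have "v \<in> verts (C3_prod_C n)"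
      using simple_C3_prod_C[OF assms(1)] ef(1) unfolding simple_graph_def by blast
    then obtain i j where ij: "v = pt i j" "j < 3" "i < n"
      by (rule verts_C3_prod_C_cases)
    then have "e \<in> star n i j" "f \<in> star n i j"
      using star_eq[OF ij(3,2)] ef v by blast+
    from S[OF this _ ij(3,2)] ef(3) show "1 \<le> \<bar>c e - c f\<bar>" "\<bar>c e - c f\<bar> \<le> r - 1"
      by (auto simp: sep_def)
  qed
qed

text \<open>Found by a breadth-first search over colourings with values in half-integers: layers 0 to 4
  lead in an odd number of steps from the bundle \<open>[3, 3, 3]\<close> back to itself.\<close>

definition triangle_col :: "nat \<Rightarrow> nat \<Rightarrow> real" where
  "triangle_col i = (!) (if i = 2 then [0, 1, 5/2] else if i = 3 then [1/2, 7/2, 5/2] else if i = 4 then [1/2, 4, 2] else [0, 1, 2])"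

definition cycle_col :: "nat \<Rightarrow> nat \<Rightarrow> real" where
  "cycle_col i = (!) (if i = 1 then [7/2, 7/2, 7/2] else if i = 2 then [0, 3/2, 5/2] else if i = 3 then [1, 4, 3/2]
     else if i = 0 \<or> odd i then [0, 1, 2] else [3, 3, 3])"

lemma all_less_3: "(\<forall>j<3. P j) \<longleftrightarrow> P 0 \<and> P 1 \<and> P (2::nat)"
  by (auto simp: less_3_cases)

lemma pattern_layer:
  assumes "odd n" "n \<ge> 5" "i < n"
  shows "layer (9/2) (triangle_col i) (cycle_col i) (cycle_col (pre n i))"
proof -
  consider "i = 0" | "i = 1" | "i = 2" | "i = 3" | "i = 4" | "i > 4" "even i" | "i > 4" "odd i" by linarith
  then show ?thesis
  proof cases
    case 1
    \<comment> \<open>The bundle entering layer 0 is that of layer \<open>n - 1\<close>, namely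
      \<open>[3, 3, 3]\<close> since \<open>n - 1\<close> is even and at least 4.\<close>
    have "n - 1 \<notin> {0, 1, 2, 3}" "even (n - 1)" using assms by auto
    then show ?thesis using 1 by (simp add: layer_def all_less_3 sep_def triangle_col_def cycle_col_def pre_def)
  qed (auto simp: layer_def all_less_3 sep_def triangle_col_def cycle_col_def pre_def)
qed

lemma circular_chromatic_index_C3_prod_C:
  assumes "odd n" "n \<ge> 5"
  shows "circular_chromatic_index (C3_prod_C n) = 9 / 2"
  unfolding circular_chromatic_index_def
proof (rule cInf_eq_minimum)
  show "9/2 \<in> {r. \<exists>c. circular_edge_colouring (C3_prod_C n) r c}"
    using layer_colouring[of n "9/2" triangle_col cycle_col] pattern_layer[OF assms] assms(2) by simp
next
  fix r assume "r \<in> {r. \<exists>c. circular_edge_colouring (C3_prod_C n) r c}"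
  then obtain c where "circular_edge_colouring (C3_prod_C n) r c" by blast
  then show "9/2 \<le> r"
    by (rule circular_edge_colouring_C3_prod_C_ge[rotated 2]) (use assms in auto)
qed

section \<open>Vertex connectivity\<close>

lemma sym_adj_rel_rtrancl: "sym ((adj_rel G)\<^sup>*)"
  by (rule sym_rtrancl) (auto simp: sym_def adj_rel_def insert_commute)

lemma connected_hub:
  assumes "h \<in> verts G" "\<And>v. v \<in> verts G \<Longrightarrow> (v, h) \<in> (adj_rel G)\<^sup>*"
  shows "connected_graph G"
proof -
  have "(h, v) \<in> (adj_rel G)\<^sup>*" if "v \<in> verts G" for v
    using sym_adj_rel_rtrancl assms(2)[OF that] by (rule symD)
  then show ?thesis
    using assms unfolding connected_graph_def by (blast intro: rtrancl_trans)
qed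

text \<open>Call the vertices with fixed \<open>j\<close> a column. If \<open>X\<close> misses a
  column, every remaining vertex has a step into it. Otherwise \<open>X\<close> has exactly one
  vertex in each of the three columns, the columns become paths, and a layer disjoint from
  \<open>X\<close> links them.\<close>

lemma connected_C3_prod_C_delete:
  assumes n: "n \<ge> 5" and X: "X \<subseteq> verts (C3_prod_C n)" "card X \<le> 3"
  shows "connected_graph (delete_verts (C3_prod_C n) X)"
proof -
  let ?G = "delete_verts (C3_prod_C n) X"
  let ?R = "(adj_rel ?G)\<^sup>*"
  note sym = symD[OF sym_adj_rel_rtrancl]
  have horiz: "(pt i j, pt i k) \<in> ?R" if "i < n" "j < 3" "k < 3" "pt i j \<notin> X" "pt i k \<notin> X" for i j k
  proof (cases "j = k")
    case False
    define l where "l = 3 - j - k"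
    have "{j, k} = {(l + 1) mod 3, (l + 2) mod 3} \<and> l < 3"
      using that(2,3) False unfolding l_def less_3_cases by (elim disjE; simp add: doubleton_eq_iff)
    then have "{pt i j, pt i k} = hedge (i, l)" "l < 3"
      by (auto simp: hedge_def doubleton_eq_iff)
    then have "{pt i j, pt i k} \<in> edges (C3_prod_C n)"
      using that(1) by (simp add: C3_prod_C_def)
    then have "{pt i j, pt i k} \<in> edges ?G"
      using that(4,5) by (simp add: delete_verts_def)
    then show ?thesis by (auto simp: adj_rel_def)
  qed simp
  have vert: "(pt (i mod n) j, pt ((i + m) mod n) j) \<in> ?R"
    if "j < 3" "\<And>k. k \<le> m \<Longrightarrow> pt ((i + k) mod n) j \<notin> X" for i j m
    using that(2)
  proof (induction m)
    case (Suc m)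
    have "vedge n ((i + m) mod n, j) = {pt ((i + m) mod n) j, pt ((i + Suc m) mod n) j}"
      by (simp add: vedge_def mod_Suc_eq)
    moreover have "vedge n ((i + m) mod n, j) \<in> edges (C3_prod_C n)"
      using that(1) n by (auto simp: C3_prod_C_def)
    ultimately have "(pt ((i + m) mod n) j, pt ((i + Suc m) mod n) j) \<in> adj_rel ?G"
      using Suc.prems[of m] Suc.prems[of "Suc m"] by (auto simp: adj_rel_def delete_verts_def)
    moreover have "(pt (i mod n) j, pt ((i + m) mod n) j) \<in> ?R"
      using Suc by auto
    ultimately show ?case by (rule rtrancl_into_rtrancl[rotated])
  qed simp
  have vert_ex: "\<exists>i j. v = pt i j \<and> i < n \<and> j < 3 \<and> pt i j \<notin> X" if "v \<in> verts ?G" for v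
  proof -
    have "v \<in> verts (C3_prod_C n)" "v \<notin> X"
      using that by (simp_all add: delete_verts_def)
    from this(1) obtain i j where "v = pt i j" "j < 3" "i < n" by (rule verts_C3_prod_C_cases)
    then show ?thesis using \<open>v \<notin> X\<close> by blast
  qed
  have pt_vert: "pt i j \<in> verts ?G" if "i < n" "j < 3" "pt i j \<notin> X" for i j
    using that by (auto simp: delete_verts_def C3_prod_C_def pt_less_iff)
  show ?thesis
  proof (cases "\<exists>j<3. \<forall>i<n. pt i j \<notin> X")
    case True
    then obtain j where j: "j < 3" "\<And>i. i < n \<Longrightarrow> pt i j \<notin> X" by blast
    show ?thesis
    proof (rule connected_hub[of "pt 0 j"])
      show "pt 0 j \<in> verts ?G" using pt_vert j n by simp
      fix v assume "v \<in> verts ?G"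
      then obtain i k where v: "v = pt i k" "i < n" "k < 3" "pt i k \<notin> X" using vert_ex by blast
      have "(v, pt i j) \<in> ?R" using horiz v j by simp
      moreover have "(pt 0 j, pt i j) \<in> ?R"
        using vert[of j i 0] j v(2) by simp
      ultimately show "(v, pt 0 j) \<in> ?R" by (rule rtrancl_trans[OF _ sym])
    qed
  next
    case False
    then obtain p where p: "\<And>j. j < 3 \<Longrightarrow> p j < n \<and> pt (p j) j \<in> X" by metis
    have inj: "inj_on (\<lambda>j. pt (p j) j) {..<3}"
      by (auto simp: inj_on_def pt_eq_iff)
    have "finite X" using X(1) finite_subset by (auto simp: C3_prod_C_def)
    \<comment> \<open>These are three distinct elements of \<open>X\<close>, and \<open>X\<close>
      has at most three.\<close>
    have X_eq: "(\<lambda>j. pt (p j) j) ` {..<3} = X"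
      by (rule card_seteq[OF \<open>finite X\<close>]) (use p X(2) card_image[OF inj] in auto)
    have X_iff: "pt i j \<in> X \<longleftrightarrow> i = p j" if "j < 3" for i j
      unfolding X_eq[symmetric] using that by (auto simp: pt_eq_iff)
    \<comment> \<open>At most three of the \<open>n \<ge> 5\<close> layers are hit, so some layer
      \<open>q\<close> is intact.\<close>
    have "card (p ` {..<3}) \<le> 3" using card_image_le[of "{..<3::nat}" p] by simp
    then have "\<not> {..<n} \<subseteq> p ` {..<3}"
      using card_mono[of "p ` {..<3}" "{..<n}"] n by auto
    then obtain q where q: "q < n" "\<And>j. j < 3 \<Longrightarrow> q \<noteq> p j" by blast
    have row: "(pt (Suc (p j) mod n) j, pt i j) \<in> ?R" if "j < 3" "i < n" "i \<noteq> p j" for i j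
    proof -
      \<comment> \<open>The number of upward steps from \<open>Suc (p j)\<close> to
        \<open>i\<close>, with wrap-around in the second case. The bound \<open>m < n - 1\<close>
        keeps the walk off the deleted \<open>p j\<close>.\<close>
      define m where "m = (if p j < i then i - Suc (p j) else i + n - Suc (p j))"
      have m: "(Suc (p j) + m) mod n = i" "m < n - 1"
        using that p[OF that(1)] by (auto simp: m_def)
      have "(Suc (p j) + k) mod n \<noteq> p j" if "k \<le> m" for k
      proof (cases "Suc (p j) + k < n")
        case False
        moreover have "k < n - 1" "p j < n" using that m(2) p[OF \<open>j < 3\<close>] by auto
        ultimately have "(Suc (p j) + k) mod n = Suc (p j) + k - n"
          by (subst le_mod_geq) (simp_all del: add_Suc)
        then show ?thesis using False \<open>k < n - 1\<close> by linarith
      qed simp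
      then show ?thesis
        using vert[of j m "Suc (p j)"] m(1) X_iff[OF that(1)] that(1) by simp
    qed
    show ?thesis
    proof (rule connected_hub[of "pt q 0"])
      show "pt q 0 \<in> verts ?G" using pt_vert X_iff q by simp
      fix v assume "v \<in> verts ?G"
      then obtain i k where v: "v = pt i k" "i < n" "k < 3" "pt i k \<notin> X" using vert_ex by blast
      have "(pt (Suc (p k) mod n) k, pt i k) \<in> ?R" "(pt (Suc (p k) mod n) k, pt q k) \<in> ?R"
        using row[of k i] row[of k q] q v X_iff by simp_all
      then have "(v, pt q k) \<in> ?R"
        unfolding v(1) by (rule rtrancl_trans[OF sym])
      moreover have "(pt q k, pt q 0) \<in> ?R" using horiz q v X_iff by simp
      ultimately show "(v, pt q 0) \<in> ?R" by (rule rtrancl_trans)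
    qed
  qed
qed

lemma vertex_connected_C3_prod_C: "n \<ge> 5 \<Longrightarrow> vertex_connected 4 (C3_prod_C n)"
  using connected_C3_prod_C_delete unfolding vertex_connected_def
  by (auto simp: C3_prod_C_def)

section \<open>Infinitely many pairwise non-isomorphic examples\<close>

lemma card_verts_C3_prod_C: "card (verts (C3_prod_C n)) = 3 * n"
  by (simp add: C3_prod_C_def)

lemma graph_iso_card: "graph_iso G H \<Longrightarrow> card (verts G) = card (verts H)"
  unfolding graph_iso_def using bij_betw_same_card by blast

theorem theorem9:
  "\<exists>\<G> :: nat ugraph set.
     infinite \<G> \<and>
     (\<forall>G\<in>\<G>. \<forall>H\<in>\<G>. G \<noteq> H \<longrightarrow> \<not> graph_iso G H) \<and>
     (\<forall>G\<in>\<G>. simple_graph G \<and> vertex_connected 4 G \<and> regular 4 G \<and>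
        circular_chromatic_index G = 9 / 2)"
proof (intro exI conjI ballI impI)
  \<comment> \<open>\<open>2 * m + 5\<close> runs through the odd numbers from 5 on; the vertex
    count tells the graphs apart.\<close>
  let ?F = "\<lambda>m. C3_prod_C (2 * m + 5)"
  have "inj ?F"
    by (rule injI, drule arg_cong[of _ _ "\<lambda>G. card (verts G)"]) (simp add: card_verts_C3_prod_C)
  then show "infinite (range ?F)" by (simp add: finite_image_iff)
  show "\<not> graph_iso G H" if "G \<in> range ?F" "H \<in> range ?F" "G \<noteq> H" for G H
    using that graph_iso_card[of G H] by (auto simp: card_verts_C3_prod_C)
  fix G assume "G \<in> range ?F"
  then obtain m where "G = ?F m" by blast
  then show "simple_graph G" "vertex_connected 4 G" "regular 4 G" "circular_chromatic_index G = 9 / 2"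
    using simple_C3_prod_C vertex_connected_C3_prod_C regular_C3_prod_C circular_chromatic_index_C3_prod_C
    by simp_all
qed

end
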